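(* Let $p\ge0$, $D>0$ and let $\theta$ be uniformly distributed in $[0,2\pi]$. Consider the deterministic and stochastic Fokker-Planck equations of the inelastic Kac model on $\mathbb{R}$, $$\partial_\tau g-\partial_v(vg)=\frac{D^2}{2}\partial_v^2g,\qquad \partial_\tau f-\big(1-\cos\theta|\cos\theta|^p\big)\partial_v(vf)=\frac{D^2}{2}\partial_v^2f .$$ Their stationary probability densities $g^\infty=g^\infty(v)$ and, for $\theta\in(0,2\pi)$, $f^\infty=f^\infty(v;\theta)$ are $$g^\infty(v)=\frac{1}{D\sqrt\pi}e^{-v^2/D^2},\qquad f^\infty(v;\theta)=\frac{\sqrt{1-\cos\theta|\cos\theta|^p}}{D\sqrt\pi}\,e^{-(1-\cos\theta|\cos\theta|^p)v^2/D^2}.$$ They have zero mean for all $\theta\in(0,2\pi)$, and their energies are $$E_{g^\infty}=\frac{D^2}{2},\qquad E_{f^\infty}(\theta)=\frac{D^2}{2\left(1-\cos\theta|\cos\theta|^p\right)},$$ whereas the $\theta$-averaged energy of the stochastic model is infinite: $$E_{\bar f^\infty}=\frac1{2\pi}\int_0^{2\pi}E_{f^\infty}(\theta)\,d\theta=+\infty .$$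
   Context: The unknowns are $g=g(\tau,v)$ and, for each fixed $\theta$, $f=f(\tau,v;\theta)$, with $\tau>0$, $v\in\mathbb{R}$. A stationary probability density is a $\tau$-independent nonnegative solution of unit integral over $\mathbb{R}$. For $h=g^\infty$ or $h=f^\infty(\cdot;\theta)$ the mean is $\int_{\mathbb{R}}v\,h(v)\,dv$ and the energy is $E_h=\int_{\mathbb{R}}v^2h(v)\,dv$; $E_{f^\infty}(\theta)$ denotes the energy of $f^\infty(\cdot;\theta)$. $E_{\bar f^\infty}$ is the energy of the $\theta$-averaged distribution $\bar f^\infty(v)=\frac1{2\pi}\int_0^{2\pi}f^\infty(v;\theta)\,d\theta$. *)

theory Defs
  imports "HOL-Probability.Probability"
begin

text \<open>
  Classical solutions, on \<open>\<tau> > 0\<close>, of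
  \<open>\<partial>\<^sub>\<tau> u - a \<partial>\<^sub>v (v u) = (D\<^sup>2/2) \<partial>\<^sub>v\<^sup>2 u\<close>. The deterministic equation is the case \<open>a = 1\<close>,
  the stochastic one, for fixed \<open>\<theta>\<close>, the case \<open>a = drift p \<theta>\<close>. Differentiability is required
  explicitly because \<open>deriv\<close> is an unspecified value where no derivative exists.
\<close>

definition fokker_planck_solution :: "real \<Rightarrow> real \<Rightarrow> (real \<Rightarrow> real \<Rightarrow> real) \<Rightarrow> bool" where
  "fokker_planck_solution a D u \<longleftrightarrow>
    (\<forall>\<tau>>0. \<forall>v.
      (\<lambda>s. u s v) differentiable at \<tau> \<and>
      u \<tau> differentiable at v \<and>
      deriv (u \<tau>) differentiable at v \<and>
      deriv (\<lambda>s. u s v) \<tau> - a * deriv (\<lambda>w. w * u \<tau> w) v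
        = D\<^sup>2 / 2 * deriv (deriv (u \<tau>)) v)"

definition stationary_density :: "real \<Rightarrow> real \<Rightarrow> (real \<Rightarrow> real) \<Rightarrow> bool" where
  "stationary_density a D h \<longleftrightarrow>
    fokker_planck_solution a D (\<lambda>\<tau>. h) \<and> (\<forall>v. 0 \<le> h v) \<and> has_bochner_integral lborel h 1"

text \<open>
  When \<open>p = 0\<close> and \<open>cos \<theta> = 0\<close>, the convention \<open>0 powr 0 = 0\<close> is harmless, since the power is
  multiplied by \<open>cos \<theta>\<close>.
\<close>

definition drift :: "real \<Rightarrow> real \<Rightarrow> real" where
  "drift p \<theta> = 1 - cos \<theta> * \<bar>cos \<theta>\<bar> powr p"

definition g_inf :: "real \<Rightarrow> real \<Rightarrow> real" where
  "g_inf D v = 1 / (D * sqrt pi) * exp (- (v\<^sup>2 / D\<^sup>2))"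

definition f_inf :: "real \<Rightarrow> real \<Rightarrow> real \<Rightarrow> real \<Rightarrow> real" where
  "f_inf p D \<theta> v = sqrt (drift p \<theta>) / (D * sqrt pi) * exp (- (drift p \<theta> * v\<^sup>2 / D\<^sup>2))"

definition f_inf_bar :: "real \<Rightarrow> real \<Rightarrow> real \<Rightarrow> real" where
  "f_inf_bar p D v = 1 / (2 * pi) * (LINT \<theta>:{0..2 * pi}|lborel. f_inf p D \<theta> v)"

definition mean :: "(real \<Rightarrow> real) \<Rightarrow> real" where
  "mean h = (LINT v|lborel. v * h v)"

text \<open>The energy of a density may be infinite, so it is taken in the extended nonnegative reals.\<close>

definition energy :: "(real \<Rightarrow> real) \<Rightarrow> ennreal" where
  "energy h = (\<integral>\<^sup>+v. ennreal (v\<^sup>2 * h v) \<partial>lborel)"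

end

theory Submission
  imports Defs
begin

text \<open>
  A stationary solution \<open>h\<close> has constant flux \<open>C = D\<^sup>2/2 h' + a v h\<close>, so the derivative of
  \<open>q(v) = h(v) exp (a v\<^sup>2/D\<^sup>2)\<close> is \<open>2C/D\<^sup>2\<close> times a function \<open>\<ge> 1\<close>. If \<open>C \<noteq> 0\<close>, then \<open>q\<close> becomes negative
  on one side, contradicting \<open>h \<ge> 0\<close>; hence \<open>C = 0\<close> and \<open>h\<close> is the centred Gaussian of variance
  \<open>D\<^sup>2/(2a)\<close>. The averaged energy diverges because \<open>drift p \<theta> = O(\<theta>\<^sup>2)\<close> as \<open>\<theta> \<rightarrow> 0\<close>.
\<close>

section \<open>The stationary equation as an ordinary differential equation\<close>

lemma has_real_derivative_normal_density_zero:
  assumes "\<sigma> > 0"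
  shows "(normal_density 0 \<sigma> has_real_derivative - (v / \<sigma>\<^sup>2) * normal_density 0 \<sigma> v) (at v)"
  unfolding normal_density_def using assms
  by (auto intro!: derivative_eq_intros simp: field_simps power2_eq_square)

text \<open>A constant family has zero time derivative, and the product rule expands the drift term,
  so no time variable remains.\<close>

lemma fokker_planck_stationary_iff:
  "fokker_planck_solution a D (\<lambda>\<tau>. h) \<longleftrightarrow>
    (\<forall>v. h differentiable at v \<and> deriv h differentiable at v \<and>
      D\<^sup>2 / 2 * deriv (deriv h) v + a * (h v + v * deriv h v) = 0)"
proof -
  have flux: "deriv (\<lambda>w. w * h w) v = h v + v * deriv h v" if "h differentiable at v" for v
    using that
    by (intro DERIV_imp_deriv)
       (auto intro!: derivative_eq_intros simp: DERIV_deriv_iff_real_differentiable)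
  have ode: "deriv (\<lambda>s. h v) \<tau> - a * deriv (\<lambda>w. w * h w) v = D\<^sup>2 / 2 * deriv (deriv h) v \<longleftrightarrow>
      D\<^sup>2 / 2 * deriv (deriv h) v + a * (h v + v * deriv h v) = 0"
    if "h differentiable at v" for v and \<tau> :: real
    unfolding flux[OF that] deriv_const by linarith
  have const: "(\<lambda>s. h v) differentiable at \<tau>" for v and \<tau> :: real by simp
  show ?thesis
    \<comment> \<open>\<open>zero_less_one\<close> supplies a positive time at which to instantiate
      the quantifier over \<open>\<tau>\<close>.\<close>
    unfolding fokker_planck_solution_def using ode const zero_less_one by blast
qed

section \<open>Slopes of nonnegative functions\<close>

lemma affine_nonneg_at_bot:
  fixes b c :: real
  assumes "\<And>x. x \<le> 0 \<Longrightarrow> 0 \<le> b + c * x"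
  shows "c \<le> 0"
proof (rule ccontr)
  assume "\<not> c \<le> 0"
  then have c: "c > 0" by simp
  \<comment> \<open>At this point the affine function equals \<open>b - \<bar>b\<bar> - 1\<close>,
    which is at most -1.\<close>
  have "0 \<le> b + c * (- (\<bar>b\<bar> + 1) / c)"
    using c by (intro assms) (simp add: divide_nonpos_pos)
  then show False using c by simp
qed

text \<open>The function \<open>q v - c * v\<close> is nondecreasing, so to the left of 0 the
  nonnegative \<open>q\<close> lies below the line \<open>q 0 + c * x\<close>; a positive
  \<open>c\<close> would push that line below zero.\<close>

lemma nonneg_function_slope_le:
  fixes q :: "real \<Rightarrow> real"
  assumes q: "\<And>v. 0 \<le> q v"
    and q': "\<And>v. (q has_real_derivative k v) (at v)"
    and k: "\<And>v. c \<le> k v"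
  shows "c \<le> 0"
proof (rule affine_nonneg_at_bot)
  fix x :: real
  assume "x \<le> 0"
  have "q x - c * x \<le> q 0 - c * 0"
  proof (rule DERIV_nonneg_imp_nondecreasing[OF \<open>x \<le> 0\<close>])
    fix y
    show "\<exists>z. ((\<lambda>v. q v - c * v) has_real_derivative z) (at y) \<and> 0 \<le> z"
      using k[of y] by (intro exI[of _ "k y - c"]) (auto intro!: derivative_eq_intros q')
  qed
  then show "0 \<le> q 0 + c * x" using q[of x] by simp
qed

section \<open>Existence and uniqueness of the stationary density\<close>

text \<open>Existence half, parametrised by the standard deviation:
  \<open>\<sigma> * sqrt (2 * a)\<close> is the positive \<open>D\<close> with
  \<open>D\<^sup>2 / (2 * a) = \<sigma>\<^sup>2\<close>.\<close>

lemma stationary_density_normal_density: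
  assumes "a > 0" and \<sigma>: "\<sigma> > 0"
  shows "stationary_density a (\<sigma> * sqrt (2 * a)) (normal_density 0 \<sigma>)"
proof -
  let ?n = "normal_density 0 \<sigma>"
  note n' = has_real_derivative_normal_density_zero[OF \<sigma>]
  \<comment> \<open>The moment of order 0 is the total mass.\<close>
  have n_int: "has_bochner_integral lborel ?n 1"
    using normal_moment_even[OF \<sigma>, of 0 0] by simp
  have dn: "deriv ?n = (\<lambda>v. - (v / \<sigma>\<^sup>2) * ?n v)"
    using n' by (auto intro: DERIV_imp_deriv)
  have n'': "(deriv ?n has_real_derivative
      - (1 / \<sigma>\<^sup>2) * ?n v + - (v / \<sigma>\<^sup>2) * (- (v / \<sigma>\<^sup>2) * ?n v)) (at v)" for v
    unfolding dn using \<sigma>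
    by (auto intro!: derivative_eq_intros n' simp: field_simps)
  have ode: "(\<sigma> * sqrt (2 * a))\<^sup>2 / 2 * deriv (deriv ?n) v + a * (?n v + v * deriv ?n v) = 0" for v
    unfolding DERIV_imp_deriv[OF n''] unfolding dn using \<sigma> \<open>a > 0\<close>
    by (simp add: field_simps power2_eq_square)
  have diff: "?n differentiable at v" "deriv ?n differentiable at v" for v
    unfolding real_differentiable_def by (rule exI, rule n' n'')+
  show ?thesis
    unfolding stationary_density_def fokker_planck_stationary_iff
    by (intro conjI allI diff ode normal_density_nonneg n_int)
qed

lemma stationary_density_imp_normal_density:
  assumes a: "a > 0" and D: "D > 0" and st: "stationary_density a D h"
  shows "h = normal_density 0 (D / sqrt (2 * a))"
proof -
  define \<sigma> where "\<sigma> = D / sqrt (2 * a)"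
  have \<sigma>: "\<sigma> > 0" using a D by (simp add: \<sigma>_def)
  have \<sigma>2: "\<sigma>\<^sup>2 = D\<^sup>2 / (2 * a)" using a by (simp add: \<sigma>_def power_divide)
  let ?n = "normal_density 0 \<sigma>"
  have n_int: "has_bochner_integral lborel ?n 1"
    using normal_moment_even[OF \<sigma>, of 0 0] by simp
  from st have nonneg: "0 \<le> h v" and h_int: "has_bochner_integral lborel h 1"
    and h': "(h has_real_derivative deriv h v) (at v)"
    and h'': "(deriv h has_real_derivative deriv (deriv h) v) (at v)"
    and ode: "D\<^sup>2 / 2 * deriv (deriv h) v + a * (h v + v * deriv h v) = 0" for v
    unfolding stationary_density_def fokker_planck_stationary_iff
    by (auto simp: DERIV_deriv_iff_real_differentiable)
  \<comment> \<open>The conserved flux, read off at 0, where the drift term vanishes.\<close>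
  define C where "C = D\<^sup>2 / 2 * deriv h 0"
  have first_integral: "D\<^sup>2 / 2 * deriv h v + a * (v * h v) = C" for v
  proof -
    have "((\<lambda>v. D\<^sup>2 / 2 * deriv h v + a * (v * h v)) has_real_derivative 0) (at x)" for x
      using ode[of x] by (auto intro!: derivative_eq_intros h' h'' simp: field_simps)
    from DERIV_isconst_all[OF allI, OF this, of v 0] show ?thesis
      by (simp add: C_def)
  qed
  \<comment> \<open>The integrating factor of the first-order equation for \<open>h\<close>, equal
    to \<open>exp (a * v\<^sup>2 / D\<^sup>2)\<close>.\<close>
  let ?w = "\<lambda>v. exp (v\<^sup>2 / (2 * \<sigma>\<^sup>2))"
  define q where "q v = h v * ?w v" for v
  have q_nonneg: "0 \<le> q v" for v using nonneg by (simp add: q_def)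
  have q': "(q has_real_derivative 2 * C / D\<^sup>2 * ?w v) (at v)" for v
  proof -
    have "(q has_real_derivative (deriv h v + v / \<sigma>\<^sup>2 * h v) * ?w v) (at v)"
      unfolding q_def using \<sigma>
      by (auto intro!: derivative_eq_intros h' simp: field_simps)
    moreover have "deriv h v + v / \<sigma>\<^sup>2 * h v = 2 * C / D\<^sup>2"
      unfolding first_integral[of v, symmetric] \<sigma>2 using a D
      by (simp add: field_simps)
    ultimately show ?thesis by simp
  qed
  \<comment> \<open>This bounds the derivative of \<open>q\<close> away from zero, with the sign of
    \<open>C\<close>, as soon as \<open>C\<close> is nonzero.\<close>
  have w_ge: "1 \<le> ?w v" for v by simp
  have "C = 0"
  proof (rule antisym)
    show "C \<le> 0"
    proof (rule ccontr)
      assume "\<not> C \<le> 0"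
      then have C: "C > 0" by simp
      have "2 * C / D\<^sup>2 \<le> 0"
        using q_nonneg q' mult_left_mono[OF w_ge, of "2 * C / D\<^sup>2"] C
        by (intro nonneg_function_slope_le[of q "\<lambda>v. 2 * C / D\<^sup>2 * ?w v"]) auto
      then show False using C D by (simp add: divide_le_0_iff)
    qed
    show "0 \<le> C"
    proof (rule ccontr)
      assume "\<not> 0 \<le> C"
      then have C: "C < 0" by simp
      \<comment> \<open>Reflection reduces negative flux to the previous case: the weight is even,
        so only the sign of the slope changes.\<close>
      have "((\<lambda>v. q (- v)) has_real_derivative - (2 * C / D\<^sup>2) * ?w v) (at v)" for v
        using DERIV_chain'[OF DERIV_minus[OF DERIV_ident] q', of v] by (simp add: mult_ac)
      then have "- (2 * C / D\<^sup>2) \<le> 0"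
        using q_nonneg mult_left_mono[OF w_ge, of "- (2 * C / D\<^sup>2)"] C
        by (intro nonneg_function_slope_le[of "\<lambda>v. q (- v)" "\<lambda>v. - (2 * C / D\<^sup>2) * ?w v"])
           (auto simp: divide_nonpos_nonneg)
      then show False using C D by (simp add: divide_le_0_iff zero_le_divide_iff)
    qed
  qed
  then have q_const: "q v = q 0" for v
    using q' by (intro DERIV_isconst_all) auto
  \<comment> \<open>The root cancels the normalising constant of \<open>normal_density\<close>;
    comparing total masses below then forces \<open>A = 1\<close>.\<close>
  define A where "A = q 0 * sqrt (2 * pi * \<sigma>\<^sup>2)"
  have "h v = A * ?n v" for v
  proof -
    have "h v = q v * exp (- (v\<^sup>2 / (2 * \<sigma>\<^sup>2)))"
      by (simp add: q_def exp_minus field_simps)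
    then show ?thesis
      using \<sigma> unfolding q_const[of v] by (simp add: A_def normal_density_def)
  qed
  then have h_eq: "h = (\<lambda>v. A * ?n v)" by blast
  have "has_bochner_integral lborel h (A * 1)"
    unfolding h_eq by (intro has_bochner_integral_mult_right n_int)
  then have "A = 1"
    using h_int by (auto dest: has_bochner_integral_eq)
  then show ?thesis
    unfolding h_eq by (simp add: \<sigma>_def)
qed

lemma stationary_density_iff_normal_density:
  assumes "a > 0" "D > 0"
  shows "stationary_density a D h \<longleftrightarrow> h = normal_density 0 (D / sqrt (2 * a))"
proof -
  have "D / sqrt (2 * a) > 0" "D / sqrt (2 * a) * sqrt (2 * a) = D"
    using assms by simp_all
  then have "stationary_density a D (normal_density 0 (D / sqrt (2 * a)))"
    using stationary_density_normal_density[OF assms(1), of "D / sqrt (2 * a)"] by simp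
  then show ?thesis
    using stationary_density_imp_normal_density[OF assms] by blast
qed

section \<open>Moments of the Gaussian stationary densities\<close>

text \<open>Integrability is recorded as well because the Bochner integral of a non-integrable
  function is 0 by default, so a zero \<open>mean\<close> alone would say little.\<close>

lemma mean_normal_density:
  assumes "\<sigma> > 0"
  shows "integrable lborel (\<lambda>v. v * normal_density 0 \<sigma> v)" "mean (normal_density 0 \<sigma>) = 0"
  using normal_moment_nz_1[OF assms, of 0]
  by (auto simp: mean_def mult.commute has_bochner_integral_iff)

lemma energy_normal_density:
  assumes "\<sigma> > 0"
  shows "energy (normal_density 0 \<sigma>) = ennreal (\<sigma>\<^sup>2)"
proof -
  have "has_bochner_integral lborel (\<lambda>v. v\<^sup>2 * normal_density 0 \<sigma> v) (\<sigma>\<^sup>2)"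
    using normal_moment_even[OF assms, of 0 1] by (simp add: mult.commute)
  then show ?thesis
    unfolding energy_def by (subst nn_integral_eq_integral) (auto simp: has_bochner_integral_iff)
qed

text \<open>The unreduced \<open>2 * 1\<close> keeps the shape \<open>sqrt (2 * a)\<close> at
  \<open>a = 1\<close>, matching the general results.\<close>

lemma g_inf_eq_normal_density:
  assumes "D > 0"
  shows "g_inf D = normal_density 0 (D / sqrt (2 * 1))"
  using assms by (auto simp: g_inf_def normal_density_def power_divide real_sqrt_mult)

lemma f_inf_eq_normal_density:
  assumes "D > 0" "drift p \<theta> > 0"
  shows "f_inf p D \<theta> = normal_density 0 (D / sqrt (2 * drift p \<theta>))"
  using assms
  by (auto simp: f_inf_def normal_density_def power_divide real_sqrt_mult real_sqrt_divide field_simps)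

section \<open>Bounds on the drift coefficient\<close>

lemma abs_cos_powr_le_one: "p \<ge> 0 \<Longrightarrow> \<bar>cos \<theta>\<bar> powr p \<le> (1::real)"
  by (intro powr_le1) auto

lemma drift_bounds:
  assumes "p \<ge> 0"
  shows "0 \<le> drift p \<theta>" "drift p \<theta> \<le> 2"
proof -
  have "\<bar>cos \<theta> * \<bar>cos \<theta>\<bar> powr p\<bar> \<le> 1 * 1"
    unfolding abs_mult using abs_cos_powr_le_one[OF assms, of \<theta>] by (intro mult_mono) auto
  then show "0 \<le> drift p \<theta>" "drift p \<theta> \<le> 2" by (auto simp: drift_def abs_le_iff)
qed

text \<open>If the cosine is nonpositive, the drift is at least 1. Otherwise it is at least
  \<open>1 - cos \<theta>\<close>, which vanishes only at multiples of \<open>2 * pi\<close>, and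
  the open interval contains none.\<close>

lemma drift_pos:
  assumes "p \<ge> 0" "\<theta> \<in> {0<..<2 * pi}"
  shows "0 < drift p \<theta>"
proof (cases "cos \<theta> \<le> 0")
  case True
  then have "cos \<theta> * \<bar>cos \<theta>\<bar> powr p \<le> 0" by (simp add: mult_nonpos_nonneg)
  then show ?thesis by (simp add: drift_def)
next
  case False
  have "cos \<theta> \<noteq> 1"
  proof
    assume "cos \<theta> = 1"
    then obtain n :: int where n: "\<theta> = of_int n * 2 * pi" using cos_one_2pi_int by blast
    with assms have "0 < n" "n < 1"
      by (auto simp: zero_less_mult_iff)
    then show False by simp
  qed
  then have "cos \<theta> < 1" using cos_le_one[of \<theta>] by linarith
  moreover have "cos \<theta> * \<bar>cos \<theta>\<bar> powr p \<le> cos \<theta> * 1"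
    using False abs_cos_powr_le_one[OF assms(1), of \<theta>] by (intro mult_left_mono) auto
  ultimately show ?thesis by (simp add: drift_def)
qed

text \<open>Rounding the exponent up to the natural number \<open>N\<close> only lowers a power of a
  cosine in (0,1]. Bernoulli's inequality then bounds the drift by \<open>N + 1\<close> times
  \<open>1 - cos \<theta>\<close>, which is quadratically small by the half-angle formula.\<close>

lemma drift_le_square:
  fixes N :: nat
  assumes "p \<ge> 0" "p \<le> real N" "0 < \<theta>" "\<theta> < pi / 2"
  shows "drift p \<theta> \<le> real (Suc N) * \<theta>\<^sup>2 / 2"
proof -
  have c: "0 < cos \<theta>" using assms by (intro cos_gt_zero) auto
  have "1 - cos \<theta> = 2 * (sin (\<theta> / 2))\<^sup>2"
    using cos_double_sin[of "\<theta> / 2"] by simp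
  also have "\<dots> \<le> 2 * (\<theta> / 2)\<^sup>2"
    using abs_sin_x_le_abs_x[of "\<theta> / 2"] by (simp only: abs_le_square_iff)
  finally have quad: "1 - cos \<theta> \<le> \<theta>\<^sup>2 / 2" by (simp add: power_divide)
  \<comment> \<open>The exponent is \<open>Suc N\<close> because the drift carries one extra factor
    \<open>cos \<theta>\<close>.\<close>
  have "1 + real (Suc N) * (cos \<theta> - 1) \<le> (1 + (cos \<theta> - 1)) ^ Suc N"
    by (rule Bernoulli_inequality) (use c in simp)
  also have "\<dots> = cos \<theta> * cos \<theta> powr real N" using c by (simp add: powr_realpow)
  also have "\<dots> \<le> cos \<theta> * \<bar>cos \<theta>\<bar> powr p"
    using c assms by (auto intro!: mult_left_mono powr_mono')
  finally have "drift p \<theta> \<le> real (Suc N) * (1 - cos \<theta>)"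
    by (simp add: drift_def algebra_simps)
  also have "\<dots> \<le> real (Suc N) * (\<theta>\<^sup>2 / 2)" by (intro mult_left_mono quad) simp
  finally show ?thesis by simp
qed

section \<open>Energy, measurability and bounds of the stochastic density\<close>

lemma energy_f_inf:
  assumes "p \<ge> 0" "D > 0" "\<theta> \<in> {0<..<2 * pi}"
  shows "energy (f_inf p D \<theta>) = ennreal (D\<^sup>2 / (2 * drift p \<theta>))"
  using drift_pos[OF assms(1,3)] assms(2)
  by (simp add: f_inf_eq_normal_density energy_normal_density power_divide)

text \<open>Joint measurability in angle and velocity is what exchanging the two integrals
  requires.\<close>

lemma measurable_f_inf [measurable]:
  "(\<lambda>(\<theta>, v). f_inf p D \<theta> v) \<in> borel_measurable (borel \<Otimes>\<^sub>M borel)"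
  unfolding f_inf_def drift_def by measurable

lemma measurable_energy_f_inf [measurable]: "(\<lambda>\<theta>. energy (f_inf p D \<theta>)) \<in> borel_measurable borel"
  unfolding energy_def by measurable

lemma f_inf_nonneg: "p \<ge> 0 \<Longrightarrow> D > 0 \<Longrightarrow> 0 \<le> f_inf p D \<theta> v"
  using drift_bounds(1)[of p \<theta>] by (simp add: f_inf_def)

text \<open>The exponential is at most 1 and the drift at most 2. The bound is uniform in the angle
  and so yields integrability over the bounded angular interval.\<close>

lemma f_inf_le:
  assumes "p \<ge> 0" "D > 0"
  shows "f_inf p D \<theta> v \<le> sqrt 2 / (D * sqrt pi)"
proof -
  have "f_inf p D \<theta> v \<le> sqrt (drift p \<theta>) / (D * sqrt pi) * 1"
    unfolding f_inf_def using drift_bounds[OF assms(1), of \<theta>] assms(2)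
    by (intro mult_left_mono) auto
  also have "\<dots> \<le> sqrt 2 / (D * sqrt pi)"
    using drift_bounds[OF assms(1), of \<theta>] assms(2) by (simp add: divide_right_mono)
  finally show ?thesis .
qed

section \<open>Averages over the angle\<close>

text \<open>Passes from the Bochner integral in \<open>f_inf_bar\<close> to a nonnegative integral,
  to which Tonelli applies; the integrand is nonnegative and bounded on a set of finite
  measure.\<close>

lemma ennreal_f_inf_bar:
  assumes "p \<ge> 0" "D > 0"
  shows "ennreal (f_inf_bar p D v)
    = ennreal (1 / (2 * pi)) * (\<integral>\<^sup>+\<theta>\<in>{0..2 * pi}. ennreal (f_inf p D \<theta> v) \<partial>lborel)"
proof -
  have "set_integrable lborel {0..2 * pi} (\<lambda>\<theta>. f_inf p D \<theta> v)"
    unfolding set_integrable_def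
  proof (rule integrableI_bounded_set_indicator[where B = "sqrt 2 / (D * sqrt pi)"])
    show "AE \<theta> in lborel. \<theta> \<in> {0..2 * pi} \<longrightarrow> norm (f_inf p D \<theta> v) \<le> sqrt 2 / (D * sqrt pi)"
      using f_inf_le[OF assms] f_inf_nonneg[OF assms] by simp
  qed (auto simp: emeasure_lborel_Icc_eq)
  then have "ennreal (LINT \<theta>:{0..2 * pi}|lborel. f_inf p D \<theta> v)
      = (\<integral>\<^sup>+\<theta>. ennreal (indicator {0..2 * pi} \<theta> *\<^sub>R f_inf p D \<theta> v) \<partial>lborel)"
    unfolding set_integrable_def set_lebesgue_integral_def
    by (subst nn_integral_eq_integral) (auto simp: f_inf_nonneg assms)
  also have "\<dots> = (\<integral>\<^sup>+\<theta>\<in>{0..2 * pi}. ennreal (f_inf p D \<theta> v) \<partial>lborel)"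
    by (intro nn_integral_cong) (auto split: split_indicator)
  finally show ?thesis
    unfolding f_inf_bar_def by (subst ennreal_mult') auto
qed

text \<open>Tonelli's theorem: all integrands are nonnegative, so velocity and angle may be
  exchanged whether or not the common value is finite.\<close>

lemma energy_f_inf_bar:
  assumes "p \<ge> 0" "D > 0"
  shows "energy (f_inf_bar p D)
    = ennreal (1 / (2 * pi)) * (\<integral>\<^sup>+\<theta>\<in>{0..2 * pi}. energy (f_inf p D \<theta>) \<partial>lborel)"
proof -
  let ?I = "indicator {0..2 * pi} :: real \<Rightarrow> ennreal"
  have "energy (f_inf_bar p D) = (\<integral>\<^sup>+v. ennreal (v\<^sup>2) * (ennreal (1 / (2 * pi)) *
      (\<integral>\<^sup>+\<theta>. ennreal (f_inf p D \<theta> v) * ?I \<theta> \<partial>lborel)) \<partial>lborel)"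
    unfolding energy_def by (simp add: ennreal_mult' ennreal_f_inf_bar assms)
  also have "\<dots> = (\<integral>\<^sup>+v. ennreal (1 / (2 * pi)) *
      (\<integral>\<^sup>+\<theta>. ennreal (v\<^sup>2 * f_inf p D \<theta> v) * ?I \<theta> \<partial>lborel) \<partial>lborel)"
  proof (intro nn_integral_cong)
    fix v
    have "(\<integral>\<^sup>+\<theta>. ennreal (v\<^sup>2 * f_inf p D \<theta> v) * ?I \<theta> \<partial>lborel)
        = ennreal (v\<^sup>2) * (\<integral>\<^sup>+\<theta>. ennreal (f_inf p D \<theta> v) * ?I \<theta> \<partial>lborel)"
      by (subst nn_integral_cmult[symmetric]) (auto simp: ennreal_mult' mult.assoc)
    then show "ennreal (v\<^sup>2) * (ennreal (1 / (2 * pi)) *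
          (\<integral>\<^sup>+\<theta>. ennreal (f_inf p D \<theta> v) * ?I \<theta> \<partial>lborel))
        = ennreal (1 / (2 * pi)) * (\<integral>\<^sup>+\<theta>. ennreal (v\<^sup>2 * f_inf p D \<theta> v) * ?I \<theta> \<partial>lborel)"
      by (simp only: mult.left_commute)
  qed
  also have "\<dots> = ennreal (1 / (2 * pi)) * (\<integral>\<^sup>+v.
      (\<integral>\<^sup>+\<theta>. ennreal (v\<^sup>2 * f_inf p D \<theta> v) * ?I \<theta> \<partial>lborel) \<partial>lborel)"
    by (rule nn_integral_cmult) measurable
  also have "(\<integral>\<^sup>+v. (\<integral>\<^sup>+\<theta>. ennreal (v\<^sup>2 * f_inf p D \<theta> v) * ?I \<theta> \<partial>lborel) \<partial>lborel)
      = (\<integral>\<^sup>+\<theta>. (\<integral>\<^sup>+v. ennreal (v\<^sup>2 * f_inf p D \<theta> v) * ?I \<theta> \<partial>lborel) \<partial>lborel)"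
    by (rule lborel_pair.Fubini') measurable
  also have "\<dots> = (\<integral>\<^sup>+\<theta>\<in>{0..2 * pi}. energy (f_inf p D \<theta>) \<partial>lborel)"
    \<comment> \<open>The indicator depends on the angle alone and leaves the velocity
      integral.\<close>
    unfolding energy_def by (intro nn_integral_cong nn_integral_multc) measurable
  finally show ?thesis .
qed

text \<open>Change of variables to the law of \<open>\<Theta>\<close>; the uniform measure divides
  by the interval length \<open>2 * pi\<close>. Values in \<open>ennreal\<close> allow an infinite
  expectation.\<close>

lemma nn_integral_uniform_angle:
  fixes \<Theta> :: "'\<omega> \<Rightarrow> real"
  assumes \<Theta>: "\<Theta> \<in> borel_measurable M"
    and unif: "distr M lborel \<Theta> = uniform_measure lborel {0..2 * pi}"
    and F [measurable]: "F \<in> borel_measurable borel"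
  shows "(\<integral>\<^sup>+\<omega>. F (\<Theta> \<omega>) \<partial>M) = ennreal (1 / (2 * pi)) * (\<integral>\<^sup>+\<theta>\<in>{0..2 * pi}. F \<theta> \<partial>lborel)"
proof -
  have "(\<integral>\<^sup>+\<omega>. F (\<Theta> \<omega>) \<partial>M) = (\<integral>\<^sup>+\<theta>. F \<theta> \<partial>distr M lborel \<Theta>)"
    using \<Theta> by (intro nn_integral_distr[symmetric]) auto
  also have "\<dots> = (\<integral>\<^sup>+\<theta>\<in>{0..2 * pi}. F \<theta> \<partial>lborel) / emeasure lborel {0..2 * pi}"
    unfolding unif by (rule nn_integral_uniform_measure) auto
  also have "\<dots> = ennreal (1 / (2 * pi)) * (\<integral>\<^sup>+\<theta>\<in>{0..2 * pi}. F \<theta> \<partial>lborel)"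
    by (simp add: divide_ennreal_def inverse_ennreal inverse_eq_divide mult.commute)
  finally show ?thesis .
qed

section \<open>Divergence of the averaged energy\<close>

text \<open>On (0,e) with e at most \<open>r\<close>, the integrand is at least the constant
  \<open>c / e\<^sup>2\<close>, so the integral is at least \<open>c / e\<close>, which is unbounded
  as e tends to 0.\<close>

lemma nn_integral_inverse_square_eq_top:
  fixes F :: "real \<Rightarrow> ennreal"
  assumes c: "c > 0" and r: "r > 0"
    and F: "\<And>x. 0 < x \<Longrightarrow> x < r \<Longrightarrow> ennreal (c / x\<^sup>2) \<le> F x"
  shows "(\<integral>\<^sup>+x\<in>{0..r}. F x \<partial>lborel) = \<infinity>"
proof (rule ccontr)
  assume "(\<integral>\<^sup>+x\<in>{0..r}. F x \<partial>lborel) \<noteq> \<infinity>"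
  then obtain B where B: "B \<ge> 0" "(\<integral>\<^sup>+x\<in>{0..r}. F x \<partial>lborel) = ennreal B"
    by (cases "\<integral>\<^sup>+x\<in>{0..r}. F x \<partial>lborel") auto
  \<comment> \<open>Chosen so that \<open>c / e\<close> is at least \<open>B + 1\<close>, exceeding
    the supposed value \<open>B\<close>, while (0,e) stays inside the domain.\<close>
  define e where "e = min r (c / (B + 1))"
  have e: "0 < e" "e \<le> r" "e \<le> c / (B + 1)" using c r B by (auto simp: e_def)
  have "ennreal (c / e) = ennreal (c / e\<^sup>2) * emeasure lborel {0<..<e}"
    using c e by (simp flip: ennreal_mult add: power2_eq_square)
  also have "\<dots> = (\<integral>\<^sup>+x. ennreal (c / e\<^sup>2) * indicator {0<..<e} x \<partial>lborel)"
    by (simp add: nn_integral_cmult_indicator)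
  also have "\<dots> \<le> (\<integral>\<^sup>+x\<in>{0..r}. F x \<partial>lborel)"
  proof (intro nn_integral_mono)
    fix x :: real
    show "ennreal (c / e\<^sup>2) * indicator {0<..<e} x \<le> F x * indicator {0..r} x"
    proof (cases "x \<in> {0<..<e}")
      case True
      then have "c / e\<^sup>2 \<le> c / x\<^sup>2" using c by (intro divide_left_mono power_mono) auto
      then have "ennreal (c / e\<^sup>2) \<le> F x"
        using True e by (intro order_trans[OF ennreal_leI F]) auto
      then show ?thesis using True e by simp
    qed simp
  qed
  finally have "c / e \<le> B" using B by simp
  moreover have "B + 1 \<le> c / e" using e B by (simp add: field_simps)
  ultimately show False by simp
qed

text \<open>By the quadratic bound on the drift, the energy dominates a multiple of
  \<open>1 / \<theta>\<^sup>2\<close> on (0, pi/2), and the singularity at 0 already gives an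
  infinite integral there.\<close>

lemma nn_integral_energy_f_inf:
  assumes "p \<ge> 0" "D > 0"
  shows "(\<integral>\<^sup>+\<theta>\<in>{0..2 * pi}. energy (f_inf p D \<theta>) \<partial>lborel) = \<infinity>"
proof -
  obtain N :: nat where N: "p \<le> real N" using real_arch_simple by blast
  have "(\<integral>\<^sup>+\<theta>\<in>{0..pi / 2}. energy (f_inf p D \<theta>) \<partial>lborel) = \<infinity>"
  proof (rule nn_integral_inverse_square_eq_top)
    show "0 < D\<^sup>2 / real (Suc N)" using assms by simp
    fix \<theta> :: real
    assume \<theta>: "0 < \<theta>" "\<theta> < pi / 2"
    then have \<theta>': "\<theta> \<in> {0<..<2 * pi}" by simp
    have "D\<^sup>2 / real (Suc N) / \<theta>\<^sup>2 = D\<^sup>2 / (2 * (real (Suc N) * \<theta>\<^sup>2 / 2))" by simp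
    also have "\<dots> \<le> D\<^sup>2 / (2 * drift p \<theta>)"
      using drift_pos[OF assms(1) \<theta>'] drift_le_square[OF assms(1) N \<theta>] \<theta>
      by (intro divide_left_mono mult_left_mono mult_pos_pos) auto
    finally show "ennreal (D\<^sup>2 / real (Suc N) / \<theta>\<^sup>2) \<le> energy (f_inf p D \<theta>)"
      by (simp only: energy_f_inf[OF assms \<theta>'] ennreal_leI)
  qed simp
  moreover have "(\<integral>\<^sup>+\<theta>\<in>{0..pi / 2}. energy (f_inf p D \<theta>) \<partial>lborel)
      \<le> (\<integral>\<^sup>+\<theta>\<in>{0..2 * pi}. energy (f_inf p D \<theta>) \<partial>lborel)"
    by (intro nn_integral_mono mult_left_mono) (auto split: split_indicator)
  ultimately show ?thesis by (simp add: top_unique)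
qed

theorem mainTheorem4:
  fixes p D :: real and M :: "'\<omega> measure" and \<Theta> :: "'\<omega> \<Rightarrow> real"
  assumes "p \<ge> 0" and "D > 0"
    and "prob_space M" and "\<Theta> \<in> borel_measurable M"
    and "distr M lborel \<Theta> = uniform_measure lborel {0..2 * pi}"
  shows "(\<forall>g. stationary_density 1 D g \<longleftrightarrow> g = g_inf D)
    \<and> (\<forall>\<theta>\<in>{0<..<2 * pi}. \<forall>f. stationary_density (drift p \<theta>) D f \<longleftrightarrow> f = f_inf p D \<theta>)
    \<and> integrable lborel (\<lambda>v. v * g_inf D v) \<and> mean (g_inf D) = 0
    \<and> (\<forall>\<theta>\<in>{0<..<2 * pi}.
         integrable lborel (\<lambda>v. v * f_inf p D \<theta> v) \<and> mean (f_inf p D \<theta>) = 0)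
    \<and> energy (g_inf D) = ennreal (D\<^sup>2 / 2)
    \<and> (\<forall>\<theta>\<in>{0<..<2 * pi}.
         energy (f_inf p D \<theta>) = ennreal (D\<^sup>2 / (2 * (1 - cos \<theta> * \<bar>cos \<theta>\<bar> powr p))))
    \<and> energy (f_inf_bar p D)
        = ennreal (1 / (2 * pi)) * (\<integral>\<^sup>+\<theta>\<in>{0..2 * pi}. energy (f_inf p D \<theta>) \<partial>lborel)
    \<and> (\<integral>\<^sup>+\<omega>. energy (f_inf p D (\<Theta> \<omega>)) \<partial>M)
        = ennreal (1 / (2 * pi)) * (\<integral>\<^sup>+\<theta>\<in>{0..2 * pi}. energy (f_inf p D \<theta>) \<partial>lborel)
    \<and> ennreal (1 / (2 * pi)) * (\<integral>\<^sup>+\<theta>\<in>{0..2 * pi}. energy (f_inf p D \<theta>) \<partial>lborel) = \<infinity>"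
proof -
  note D = \<open>D > 0\<close> and p = \<open>p \<ge> 0\<close>
  have \<sigma>: "0 < D / sqrt (2 * a)" if "a > 0" for a using that D by simp
  note f = f_inf_eq_normal_density[OF D drift_pos[OF p]]
  note g = g_inf_eq_normal_density[OF D]
  have "\<forall>g. stationary_density 1 D g \<longleftrightarrow> g = g_inf D"
    using stationary_density_iff_normal_density[of 1 D] D g by simp
  moreover have "\<forall>\<theta>\<in>{0<..<2 * pi}. \<forall>f. stationary_density (drift p \<theta>) D f \<longleftrightarrow> f = f_inf p D \<theta>"
    using stationary_density_iff_normal_density[OF drift_pos[OF p] D] f by simp
  moreover have "integrable lborel (\<lambda>v. v * g_inf D v)" "mean (g_inf D) = 0"
    unfolding g using mean_normal_density[OF \<sigma>[of 1]] by simp_all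
  moreover have "\<forall>\<theta>\<in>{0<..<2 * pi}.
      integrable lborel (\<lambda>v. v * f_inf p D \<theta> v) \<and> mean (f_inf p D \<theta>) = 0"
    using mean_normal_density[OF \<sigma>[OF drift_pos[OF p]]] f by simp
  moreover have "energy (g_inf D) = ennreal (D\<^sup>2 / 2)"
    unfolding g using energy_normal_density[OF \<sigma>[of 1]] by (simp add: power_divide)
  moreover have "\<forall>\<theta>\<in>{0<..<2 * pi}.
      energy (f_inf p D \<theta>) = ennreal (D\<^sup>2 / (2 * (1 - cos \<theta> * \<bar>cos \<theta>\<bar> powr p)))"
    using energy_f_inf[OF p D] by (simp add: drift_def)
  \<comment> \<open>Here the law of the random angle enters: the expected energy becomes the
    normalised angular integral.\<close>
  moreover have "(\<integral>\<^sup>+\<omega>. energy (f_inf p D (\<Theta> \<omega>)) \<partial>M)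
      = ennreal (1 / (2 * pi)) * (\<integral>\<^sup>+\<theta>\<in>{0..2 * pi}. energy (f_inf p D \<theta>) \<partial>lborel)"
    by (rule nn_integral_uniform_angle[OF assms(4,5)]) measurable
  moreover have "ennreal (1 / (2 * pi)) * (\<integral>\<^sup>+\<theta>\<in>{0..2 * pi}. energy (f_inf p D \<theta>) \<partial>lborel) = \<infinity>"
    unfolding nn_integral_energy_f_inf[OF p D] by (simp add: ennreal_mult_top)
  ultimately show ?thesis
    using energy_f_inf_bar[OF p D] by blast
qed

end
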